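(* Let $\beta$ with $0\le\beta<1$ be the gravity strength of the $\mathcal{QG}$-spacetime relative to the gravity strength $\beta_{\mathcal S}=0$ of the $\mathcal S$-spacetime, and put $\eta=1/\sqrt{1-\beta^2}$. Then every elementary region $x'$ of the $\mathcal{QG}$-spacetime (a point of the $x'$-axis, i.e. an event of the $\mathcal{QG}$-frame with coordinates $(x',ct'=0)$) is transformed onto the $\mathcal S$-spacetime via $x=\eta x'$; that is, the location coordinate $x$ in the $\mathcal S$-frame of the event with $\mathcal{QG}$-frame coordinates $(x',0)$ is $x=\eta x'$.
   Context: Work in a two-dimensional Minkowski diagram. The standard (causally-biased) $\mathcal S$-spacetime is the reference frame with orthogonal axes $x$ (location) and $ct$ (time multiplied by the constant propagation speed $c>0$); its strength parameter is $\beta_{\mathcal S}=0$. The quantum gravity (causally-unbiased) $\mathcal{QG}$-spacetime with strength parameter $\beta$, $0\le\beta<1$, is the frame with (non-curved) axes $x'$ and $ct'$ drawn in the same diagram as follows. Its origin $O'$ has $\mathcal S$-location coordinate $x=0$. The angle between the $x$-axis and the $x'$-axis, and between the $ct$-axis and the $ct'$-axis, is $\theta$ with $0^\circ\le\theta<45^\circ$ and $\beta=\tan\theta$ (both primed axes are tilted towards the bisector of the unprimed axes, as for a Lorentz-transformed frame). The unit lengths, measured as Euclidean lengths in the diagram, on the primed axes and on the unprimed axes are related by $l^{\mathcal{QG}}_{scale}=\gamma\, l^{\mathcal S}_{scale}$ with $\gamma=\sqrt{(1+\beta^2)/(1-\beta^2)}$. In the $\mathcal{QG}$-spacetime background time has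 no meaning, so all its events have $ct'=0$, i.e. they lie on the $x'$-axis. An "elementary region" is the location coordinate of an event. *)

theory Defs
  imports "HOL-Analysis.Analysis"
begin

definition vangle :: "real^2 \<Rightarrow> real^2 \<Rightarrow> real" where
  "vangle u v = arccos ((u \<bullet> v) / (norm u * norm v))"

text \<open>
  A spacetime is drawn in the Euclidean plane as a pair of straight axes through a common
  origin. The direction vectors have Euclidean norm 1; \<open>unit_len\<close> is the Euclidean length
  in the diagram that represents one unit on either axis.
\<close>

record spacetime =
  orig :: "real^2"
  loc_dir :: "real^2"
  time_dir :: "real^2"
  unit_len :: real
  strength :: real

text \<open>
  Coordinates are read off parallel to the axes. The second coordinate is the value on the
  \<open>ct\<close>-axis, that is, time already multiplied by the propagation speed.
\<close>

definition event_at :: "spacetime \<Rightarrow> real \<Rightarrow> real \<Rightarrow> real^2" where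
  "event_at F x w =
     orig F + (x * unit_len F) *\<^sub>R loc_dir F + (w * unit_len F) *\<^sub>R time_dir F"

definition location :: "spacetime \<Rightarrow> real^2 \<Rightarrow> real" where
  "location F P = (THE x. \<exists>w. P = event_at F x w)"

definition standard_spacetime :: "spacetime \<Rightarrow> bool" where
  "standard_spacetime S \<longleftrightarrow>
     norm (loc_dir S) = 1 \<and> norm (time_dir S) = 1 \<and>
     orthogonal (loc_dir S) (time_dir S) \<and>
     0 < unit_len S \<and> strength S = 0"

text \<open>
  Both axes of \<open>S\<close> are tilted by \<open>\<theta>\<close> towards their bisector, whose direction is
  \<open>loc_dir S + time_dir S\<close>. The angle alone leaves two candidates for each tilted axis; the
  one tilted towards the bisector lies in the sector (convex cone) between the old axis and
  the bisector.
\<close>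

definition tilted_axes :: "spacetime \<Rightarrow> real \<Rightarrow> spacetime \<Rightarrow> bool" where
  "tilted_axes S \<theta> Q \<longleftrightarrow>
     norm (loc_dir Q) = 1 \<and> norm (time_dir Q) = 1 \<and>
     vangle (loc_dir S) (loc_dir Q) = \<theta> \<and>
     vangle (time_dir S) (time_dir Q) = \<theta> \<and>
     loc_dir Q \<in> convex_cone hull {loc_dir S, loc_dir S + time_dir S} \<and>
     time_dir Q \<in> convex_cone hull {time_dir S, loc_dir S + time_dir S}"

definition scale_factor :: "real \<Rightarrow> real" where
  "scale_factor \<beta> = sqrt ((1 + \<beta>\<^sup>2) / (1 - \<beta>\<^sup>2))"

text \<open>The origin of \<open>Q\<close> need not coincide with that of \<open>S\<close>: only its location is fixed.\<close>

definition qg_spacetime :: "spacetime \<Rightarrow> spacetime \<Rightarrow> bool" where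
  "qg_spacetime S Q \<longleftrightarrow>
     location S (orig Q) = 0 \<and>
     (\<exists>\<theta>. 0 \<le> \<theta> \<and> \<theta> < pi / 4 \<and> strength Q = tan \<theta> \<and> tilted_axes S \<theta> Q) \<and>
     unit_len Q = scale_factor (strength Q) * unit_len S"

end

theory Submission
  imports Defs
begin

text \<open>
  In an orthonormal frame the location of an event is an orthogonal projection, hence affine in the
  event. The unit vector of the \<open>x'\<close>-axis projects to \<open>cos \<theta> = 1 / sqrt (1 + \<beta>\<^sup>2)\<close>
  on the \<open>x\<close>-axis, and the scale factor \<open>\<gamma>\<close> turns this into \<open>\<eta> = \<gamma> * cos \<theta>\<close>.
\<close>

text \<open>Orthogonal nonzero vectors are independent, and two independent vectors span the plane
  by dimension. This supplies the existence half of the definite description in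
  \<open>location\<close>.\<close>

lemma orthonormal_pair_expansion:
  fixes e f v :: "real^2"
  assumes e: "norm e = 1" and f: "norm f = 1" and ef: "orthogonal e f"
  obtains a b where "v = a *\<^sub>R e + b *\<^sub>R f"
proof -
  have ne: "e \<noteq> f"
    using e ef by (auto simp: orthogonal_def norm_eq_1)
  have "pairwise orthogonal {e, f}"
    using ef by (auto simp: pairwise_def orthogonal_commute)
  moreover have "0 \<notin> {e, f}"
    using e f by auto
  ultimately have "independent {e, f}"
    by (rule pairwise_orthogonal_independent)
  then have "UNIV \<subseteq> span {e, f}"
    using ne by (intro card_ge_dim_independent) auto
  then have "v \<in> span {e, f}" by blast
  then obtain a b where "v - a *\<^sub>R e = b *\<^sub>R f"
    by (auto simp: span_insert span_singleton)
  then have "v = a *\<^sub>R e + b *\<^sub>R f"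
    by (simp add: algebra_simps)
  then show thesis by (rule that)
qed

lemma location_standard_spacetime:
  assumes S: "standard_spacetime S"
  shows "location S P = ((P - orig S) \<bullet> loc_dir S) / unit_len S"
proof -
  have e: "norm (loc_dir S) = 1" and f: "norm (time_dir S) = 1"
    and ef: "orthogonal (loc_dir S) (time_dir S)" and u: "unit_len S > 0"
    using S by (auto simp: standard_spacetime_def)
  \<comment> \<open>Pairing with \<open>loc_dir S\<close> kills the time component, so
    \<open>x\<close> is recovered whatever \<open>w\<close> is: this is uniqueness of the
    location.\<close>
  have coord: "x = ((event_at S x w - orig S) \<bullet> loc_dir S) / unit_len S" for x w
    using e ef u
    by (simp add: event_at_def inner_add_left norm_eq_1 orthogonal_def
        inner_commute[of "time_dir S"])
  obtain a b where ab: "P - orig S = a *\<^sub>R loc_dir S + b *\<^sub>R time_dir S"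
    using orthonormal_pair_expansion[OF e f ef] .
  have P: "P = event_at S (a / unit_len S) (b / unit_len S)"
    using ab u by (simp add: event_at_def algebra_simps)
  show ?thesis
    unfolding location_def
  proof (rule the_equality)
    show "\<exists>w. P = event_at S (((P - orig S) \<bullet> loc_dir S) / unit_len S) w"
      using P coord by metis
  qed (use coord in blast)
qed

lemma cos_vangle:
  "cos (vangle u v) = (u \<bullet> v) / (norm u * norm v)"
proof -
  have "\<bar>(u \<bullet> v) / (norm u * norm v)\<bar> \<le> 1"
    \<comment> \<open>For a zero vector the quotient is 0, as division by zero yields 0.\<close>
    using Cauchy_Schwarz_ineq2[of u v] by (cases "u = 0 \<or> v = 0") auto
  then show ?thesis
    by (simp add: vangle_def cos_arccos_abs)
qed

text \<open>The numerator of \<open>scale_factor\<close> is the secant, by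
  \<open>1 + tan\<^sup>2 = sec\<^sup>2\<close>, and cancels the cosine; positivity of the cosine
  fixes the sign of the root.\<close>

lemma scale_factor_tan_times_cos:
  assumes "cos \<theta> > 0"
  shows "scale_factor (tan \<theta>) * cos \<theta> = 1 / sqrt (1 - (tan \<theta>)\<^sup>2)"
proof -
  have "1 + (tan \<theta>)\<^sup>2 = (inverse (cos \<theta>))\<^sup>2"
    using tan_sec[of \<theta>] assms by simp
  then have "sqrt (1 + (tan \<theta>)\<^sup>2) = inverse (cos \<theta>)"
    using assms by simp
  then show ?thesis
    using assms by (simp add: scale_factor_def real_sqrt_divide)
qed

theorem proposition1:
  fixes S Q :: spacetime and \<beta> \<eta> c x' t' :: real
  assumes "standard_spacetime S"
    and "qg_spacetime S Q"
    and "strength Q = \<beta>"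
    and "0 \<le> \<beta>" and "\<beta> < 1"
    and "\<eta> = 1 / sqrt (1 - \<beta>\<^sup>2)"
    and "0 < c" and "c * t' = 0"
  shows "location S (event_at Q x' (c * t')) = \<eta> * x'"
proof -
  note loc = location_standard_spacetime[OF assms(1)]
  have u: "unit_len S > 0" and e: "norm (loc_dir S) = 1"
    using assms(1) by (auto simp: standard_spacetime_def)
  obtain \<theta> where \<theta>: "0 \<le> \<theta>" "\<theta> < pi / 4" and \<beta>: "\<beta> = tan \<theta>"
    and tilt: "tilted_axes S \<theta> Q"
    using assms(2,3) by (auto simp: qg_spacetime_def)
  have "cos \<theta> > 0"
    using \<theta> by (intro cos_gt_zero_pi) auto
  then have \<eta>: "scale_factor \<beta> * cos \<theta> = \<eta>"
    using scale_factor_tan_times_cos \<beta> assms(6) by simp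
  have proj: "loc_dir Q \<bullet> loc_dir S = cos \<theta>"
    using tilt e cos_vangle[of "loc_dir S" "loc_dir Q"]
    by (simp add: tilted_axes_def inner_commute)
  \<comment> \<open>Location 0 means that the two origins differ only along the
    \<open>ct\<close>-axis, a shift invisible to the projection.\<close>
  have origin: "(orig Q - orig S) \<bullet> loc_dir S = 0"
    using assms(2) u loc[of "orig Q"] by (simp add: qg_spacetime_def)
  have unit: "unit_len Q = scale_factor \<beta> * unit_len S"
    using assms(2,3) by (simp add: qg_spacetime_def)
  have "event_at Q x' (c * t') - orig S
      = (orig Q - orig S) + (x' * unit_len Q) *\<^sub>R loc_dir Q"
    using assms(8) by (simp only: event_at_def) simp
  then have "location S (event_at Q x' (c * t')) = x' * unit_len Q * cos \<theta> / unit_len S"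
    using origin proj by (simp only: loc inner_add_left inner_scaleR_left) simp
  \<comment> \<open>The unit length of \<open>S\<close> cancels, leaving
    \<open>scale_factor \<beta> * cos \<theta>\<close> as the coefficient of
    \<open>x'\<close>.\<close>
  also have "\<dots> = \<eta> * x'"
    using u by (simp add: unit flip: \<eta>)
  finally show ?thesis .
qed

end
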